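(* Let $W$ be a real-valued potential function satisfying properties (1)–(3) listed in the context. Let $\omega\in\mathbb{R}$ and let $(u_0,v_0)$ be a decaying solution on $x\in\mathbb{R}$ of $$ i u_0' = \omega u_0 - v_0 + \partial_{\bar u_0} W(u_0,\bar u_0,v_0,\bar v_0),\qquad -i v_0' = \omega v_0 - u_0 + \partial_{\bar v_0} W(u_0,\bar u_0,v_0,\bar v_0), $$ where $v_0=\bar u_0$. There exists an orthogonal similarity transformation $S$, such that $S^{-1}=S^T$, where $$ S=\frac{1}{\sqrt2}\begin{pmatrix}1&0&1&0\\0&1&0&1\\0&1&0&-1\\1&0&-1&0\end{pmatrix}, $$ that simultaneously block-diagonalizes the energy operator $H_\omega$ (defined in the context), $$ S^{-1}H_\omega S=\begin{pmatrix}H_+&0\\0&H_-\end{pmatrix}, $$ and the linearized operator $\sigma H_\omega$, with $\sigma=\mathrm{diag}(1,-1,1,-1)$, $$ S^{-1}\sigma H_\omega S=\sigma\begin{pmatrix}0&H_-\\H_+&0\end{pmatrix}, $$ where $H_\pm$ are the two-by-two Dirac operators $$ H_\pm=\begin{pmatrix}\omega-i\partial_x&\mp1\\ \mp1&\omega+i\partial_x\end{pmatrix}+V_\pm(x), $$ $$ V_\pm=\begin{pmatrix}\partial^2_{\bar u_0u_0}\pm\partial^2_{\bar u_0\bar v_0}&\partial^2_{\bar u_0^2}\pm\partial^2_{\bar u_0v_0}\\ \partial^2_{u_0^2}\pm\partial^2_{u_0\bar v_0}&\partial^2_{\bar u_0u_0}\pm\partial^2_{u_0v_0}\end{pmatrix}W(u_0,\bar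 u_0,v_0,\bar v_0). $$
   Context: $W=W(u,\bar u,v,\bar v)$ is a function of $(u,v)\in\mathbb{C}^2$; $\partial_u,\partial_{\bar u},\partial_v,\partial_{\bar v}$ are Wirtinger derivatives ($u,\bar u,v,\bar v$ treated as independent), and $\partial_{u_0}$, $\partial^2_{\bar u_0 v_0}$, etc. denote these derivatives of $W$ evaluated at $(u,v)=(u_0(x),v_0(x))$. Properties: (1) gauge invariance: $W(u,\bar u,v,\bar v)=W(e^{i\alpha}u,e^{-i\alpha}\bar u,e^{i\alpha}v,e^{-i\alpha}\bar v)$ for all $\alpha\in\mathbb{R}$; (2) symmetry under the interchange $(u,v)\mapsto(v,u)$: $W(u,\bar u,v,\bar v)=W(v,\bar v,u,\bar u)$; (3) $W$ is analytic in its variables near $u=v=0$ and $W=O(4)$, i.e. its Taylor expansion there starts with terms of degree four. A solution is decaying if $u_0(x),v_0(x)\to0$ as $|x|\to\infty$. The energy operator is $H_\omega=D(\partial_x)+V(x)$, acting on $\mathbb{C}^4$-valued functions of $x\in\mathbb{R}$, with $$ D=\begin{pmatrix}\omega-i\partial_x&0&-1&0\\0&\omega+i\partial_x&0&-1\\-1&0&\omega+i\partial_x&0\\0&-1&0&\omega-i\partial_x\end{pmatrix}, $$ $$ V=\begin{pmatrix}\partial^2_{\bar u_0u_0}&\partial^2_{\bar u_0^2}&\partial^2_{\bar u_0v_0}&\partial^2_{\bar u_0\bar v_0}\\ \partial^2_{u_0^2}&\partial^2_{u_0\bar u_0}&\partial^2_{u_0v_0}&\partial^2_{u_0\bar v_0}\\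 \partial^2_{\bar v_0u_0}&\partial^2_{\bar v_0\bar u_0}&\partial^2_{\bar v_0v_0}&\partial^2_{\bar v_0^2}\\ \partial^2_{v_0u_0}&\partial^2_{v_0\bar u_0}&\partial^2_{v_0^2}&\partial^2_{v_0\bar v_0}\end{pmatrix}W(u_0,\bar u_0,v_0,\bar v_0). $$ The Wirtinger derivatives of $W$ that appear are understood to exist along the solution.
   Formalization: The potential is additionally assumed invariant under complex conjugation of both arguments, W(ū,u,v̄,v) = W(u,ū,v,v̄); without this the claim fails for some real-valued W satisfying (1)–(3). *)

theory Defs
  imports "HOL-Analysis.Analysis"
begin

section \<open>Wirtinger derivatives\<close>

text \<open>A function of \<open>u\<close>, \<open>cnj u\<close>, \<open>v\<close>, \<open>cnj v\<close> is a function of \<open>p = (u, v)\<close>. Differentiability of functions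
  \<open>complex \<Rightarrow> complex\<close> means real differentiability here, and existence of the Wirtinger derivatives in
  one of the two complex variables means real differentiability in that variable.\<close>

definition wirtinger :: "(complex \<Rightarrow> complex) \<Rightarrow> complex \<Rightarrow> complex" where
  "wirtinger g z =
     (frechet_derivative g (at z) 1 - \<i> * frechet_derivative g (at z) \<i>) / 2"

definition wirtinger_bar :: "(complex \<Rightarrow> complex) \<Rightarrow> complex \<Rightarrow> complex" where
  "wirtinger_bar g z =
     (frechet_derivative g (at z) 1 + \<i> * frechet_derivative g (at z) \<i>) / 2"

definition d_u :: "(complex \<times> complex \<Rightarrow> complex) \<Rightarrow> complex \<times> complex \<Rightarrow> complex" where
  "d_u W p = wirtinger (\<lambda>z. W (z, snd p)) (fst p)"

definition d_ub :: "(complex \<times> complex \<Rightarrow> complex) \<Rightarrow> complex \<times> complex \<Rightarrow> complex" where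
  "d_ub W p = wirtinger_bar (\<lambda>z. W (z, snd p)) (fst p)"

definition d_v :: "(complex \<times> complex \<Rightarrow> complex) \<Rightarrow> complex \<times> complex \<Rightarrow> complex" where
  "d_v W p = wirtinger (\<lambda>z. W (fst p, z)) (snd p)"

definition d_vb :: "(complex \<times> complex \<Rightarrow> complex) \<Rightarrow> complex \<times> complex \<Rightarrow> complex" where
  "d_vb W p = wirtinger_bar (\<lambda>z. W (fst p, z)) (snd p)"

definition wirtinger_derivs_exist ::
    "(complex \<times> complex \<Rightarrow> complex) \<Rightarrow> complex \<times> complex \<Rightarrow> bool" where
  "wirtinger_derivs_exist W p \<longleftrightarrow>
     (\<lambda>z. W (z, snd p)) differentiable (at (fst p)) \<and>
     (\<lambda>z. W (fst p, z)) differentiable (at (snd p))"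

definition second_wirtinger_derivs_exist ::
    "(complex \<times> complex \<Rightarrow> complex) \<Rightarrow> complex \<times> complex \<Rightarrow> bool" where
  "second_wirtinger_derivs_exist W p \<longleftrightarrow>
     (\<forall>\<^sub>F q in nhds p. wirtinger_derivs_exist W q) \<and>
     (\<forall>d \<in> {d_u, d_ub, d_v, d_vb}. wirtinger_derivs_exist (d W) p)"


section \<open>The potential\<close>

definition gauge_invariant :: "(complex \<times> complex \<Rightarrow> complex) \<Rightarrow> bool" where
  "gauge_invariant W \<longleftrightarrow>
     (\<forall>(\<alpha>::real) u v. W (exp (\<i> * \<alpha>) * u, exp (\<i> * \<alpha>) * v) = W (u, v))"

definition swap_symmetric :: "(complex \<times> complex \<Rightarrow> complex) \<Rightarrow> bool" where
  "swap_symmetric W \<longleftrightarrow> (\<forall>u v. W (u, v) = W (v, u))"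

text \<open>Realness of \<open>W\<close> as an expression in the four variables \<open>u\<close>, \<open>cnj u\<close>, \<open>v\<close>, \<open>cnj v\<close>: for a real-valued
  analytic \<open>W\<close> it says that the Taylor coefficients are real. A real-valued gauge and swap invariant
  \<open>W\<close> has this property iff it is a function of \<open>|u|\<^sup>2 + |v|\<^sup>2\<close>, \<open>|u|\<^sup>2 |v|\<^sup>2\<close> and
  \<open>u * cnj v + v * cnj u\<close>. It is not implied by the other conditions:
  \<open>P = \<i> (|u|\<^sup>2 - |v|\<^sup>2) (u * cnj v - v * cnj u)\<close> is real-valued, gauge and swap invariant. The
  block-diagonalization needs it: with \<open>\<omega> = 0\<close> and \<open>Q = |u|\<^sup>2 |v|\<^sup>2 - u * cnj v - v * cnj u\<close>, the
  potential \<open>W = |u|\<^sup>2 |v|\<^sup>2 + P * Q\<close> has the decaying solution \<open>u\<^sub>0 x = 1 / cosh (x + \<i> \<pi> / 4)\<close>,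
  \<open>v\<^sub>0 = cnj u\<^sub>0\<close>, along which the (1,1) and (4,4) entries of the Hessian differ.\<close>

definition conj_symmetric :: "(complex \<times> complex \<Rightarrow> complex) \<Rightarrow> bool" where
  "conj_symmetric W \<longleftrightarrow> (\<forall>u v. W (cnj u, cnj v) = W (u, v))"

definition analytic_O4_at_0 :: "(complex \<times> complex \<Rightarrow> complex) \<Rightarrow> bool" where
  "analytic_O4_at_0 W \<longleftrightarrow>
     (\<exists>(c :: nat \<times> nat \<times> nat \<times> nat \<Rightarrow> complex) r. r > 0 \<and>
        (\<forall>j k l m. j + k + l + m < 4 \<longrightarrow> c (j, k, l, m) = 0) \<and>
        (\<forall>u v. norm u < r \<longrightarrow> norm v < r \<longrightarrow>
           ((\<lambda>(j, k, l, m). c (j, k, l, m) * u ^ j * cnj u ^ k * v ^ l * cnj v ^ m)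
              has_sum W (u, v)) UNIV))"


section \<open>Stationary solutions\<close>

definition stationary_solution ::
    "real \<Rightarrow> (complex \<times> complex \<Rightarrow> complex) \<Rightarrow> (real \<Rightarrow> complex) \<Rightarrow> (real \<Rightarrow> complex) \<Rightarrow> bool" where
  "stationary_solution \<omega> W u0 v0 \<longleftrightarrow>
     (\<forall>x. u0 differentiable (at x) \<and> v0 differentiable (at x) \<and>
        \<i> * vector_derivative u0 (at x) = \<omega> * u0 x - v0 x + d_ub W (u0 x, v0 x) \<and>
        - \<i> * vector_derivative v0 (at x) = \<omega> * v0 x - u0 x + d_vb W (u0 x, v0 x))"

definition decaying :: "(real \<Rightarrow> complex) \<Rightarrow> bool" where
  "decaying f \<longleftrightarrow> (f \<longlongrightarrow> 0) at_infinity"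


section \<open>Operators\<close>

text \<open>Operators map functions \<open>real \<Rightarrow> complex ^ n\<close> to such functions; differential operators are
  meaningful on differentiable arguments.\<close>

abbreviation D_x :: "(real \<Rightarrow> complex ^ 'n) \<Rightarrow> 'n \<Rightarrow> real \<Rightarrow> complex" where
  "D_x \<Phi> k x \<equiv> vector_derivative (\<lambda>y. \<Phi> y $ k) (at x)"

definition D_op :: "real \<Rightarrow> (real \<Rightarrow> complex ^ 4) \<Rightarrow> real \<Rightarrow> complex ^ 4" where
  "D_op \<omega> \<Phi> x = vector
     [\<omega> * \<Phi> x $ 1 - \<i> * D_x \<Phi> 1 x - \<Phi> x $ 3,
      \<omega> * \<Phi> x $ 2 + \<i> * D_x \<Phi> 2 x - \<Phi> x $ 4,
      - \<Phi> x $ 1 + \<omega> * \<Phi> x $ 3 + \<i> * D_x \<Phi> 3 x,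
      - \<Phi> x $ 2 + \<omega> * \<Phi> x $ 4 - \<i> * D_x \<Phi> 4 x]"

text \<open>In \<open>d_a (d_b W)\<close> the derivative in \<open>b\<close> is taken first.\<close>

definition V_mat :: "(complex \<times> complex \<Rightarrow> complex) \<Rightarrow> complex \<times> complex \<Rightarrow> complex ^ 4 ^ 4" where
  "V_mat W p = vector
     [vector [d_ub (d_u W) p, d_ub (d_ub W) p, d_ub (d_v W) p, d_ub (d_vb W) p],
      vector [d_u (d_u W) p, d_u (d_ub W) p, d_u (d_v W) p, d_u (d_vb W) p],
      vector [d_vb (d_u W) p, d_vb (d_ub W) p, d_vb (d_v W) p, d_vb (d_vb W) p],
      vector [d_v (d_u W) p, d_v (d_ub W) p, d_v (d_v W) p, d_v (d_vb W) p]]"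

definition H_energy ::
    "real \<Rightarrow> (complex \<times> complex \<Rightarrow> complex) \<Rightarrow> (real \<Rightarrow> complex) \<Rightarrow> (real \<Rightarrow> complex) \<Rightarrow>
     (real \<Rightarrow> complex ^ 4) \<Rightarrow> real \<Rightarrow> complex ^ 4" where
  "H_energy \<omega> W u0 v0 \<Phi> x = D_op \<omega> \<Phi> x + V_mat W (u0 x, v0 x) *v \<Phi> x"

text \<open>The parameter \<open>s\<close> is the sign, \<open>1\<close> for \<open>H\<^sub>+\<close> and \<open>-1\<close> for \<open>H\<^sub>-\<close>.\<close>

definition V_sign ::
    "complex \<Rightarrow> (complex \<times> complex \<Rightarrow> complex) \<Rightarrow> complex \<times> complex \<Rightarrow> complex ^ 2 ^ 2" where
  "V_sign s W p = vector
     [vector [d_ub (d_u W) p + s * d_ub (d_vb W) p, d_ub (d_ub W) p + s * d_ub (d_v W) p],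
      vector [d_u (d_u W) p + s * d_u (d_vb W) p, d_ub (d_u W) p + s * d_u (d_v W) p]]"

definition H_sign ::
    "complex \<Rightarrow> real \<Rightarrow> (complex \<times> complex \<Rightarrow> complex) \<Rightarrow> (real \<Rightarrow> complex) \<Rightarrow> (real \<Rightarrow> complex) \<Rightarrow>
     (real \<Rightarrow> complex ^ 2) \<Rightarrow> real \<Rightarrow> complex ^ 2" where
  "H_sign s \<omega> W u0 v0 \<phi> x =
     vector [\<omega> * \<phi> x $ 1 - \<i> * D_x \<phi> 1 x - s * \<phi> x $ 2,
             - s * \<phi> x $ 1 + \<omega> * \<phi> x $ 2 + \<i> * D_x \<phi> 2 x]
     + V_sign s W (u0 x, v0 x) *v \<phi> x"

abbreviation "H_plus \<equiv> H_sign 1"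
abbreviation "H_minus \<equiv> H_sign (- 1)"

definition mat_op :: "complex ^ 'n ^ 'm \<Rightarrow> (real \<Rightarrow> complex ^ 'n) \<Rightarrow> real \<Rightarrow> complex ^ 'm" where
  "mat_op M \<Phi> x = M *v \<Phi> x"

definition zero_op :: "(real \<Rightarrow> complex ^ 'n) \<Rightarrow> real \<Rightarrow> complex ^ 'm" where
  "zero_op \<phi> x = 0"

text \<open>The operator on \<open>\<complex>\<^sup>4 = \<complex>\<^sup>2 \<oplus> \<complex>\<^sup>2\<close> valued functions with block matrix \<open>((A, B), (C, E))\<close>.\<close>

definition block_op ::
    "((real \<Rightarrow> complex ^ 2) \<Rightarrow> real \<Rightarrow> complex ^ 2) \<Rightarrow> ((real \<Rightarrow> complex ^ 2) \<Rightarrow> real \<Rightarrow> complex ^ 2) \<Rightarrow>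
     ((real \<Rightarrow> complex ^ 2) \<Rightarrow> real \<Rightarrow> complex ^ 2) \<Rightarrow> ((real \<Rightarrow> complex ^ 2) \<Rightarrow> real \<Rightarrow> complex ^ 2) \<Rightarrow>
     (real \<Rightarrow> complex ^ 4) \<Rightarrow> real \<Rightarrow> complex ^ 4" where
  "block_op A B C E \<Phi> x =
     (let \<phi> = (\<lambda>y. vector [\<Phi> y $ 1, \<Phi> y $ 2]);
          \<psi> = (\<lambda>y. vector [\<Phi> y $ 3, \<Phi> y $ 4]);
          a = A \<phi> x + B \<psi> x;
          b = C \<phi> x + E \<psi> x
      in vector [a $ 1, a $ 2, b $ 1, b $ 2])"

definition S_mat :: "complex ^ 4 ^ 4" where
  "S_mat = (\<chi> i j. complex_of_real (1 / sqrt 2) *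
     (vector [vector [1, 0, 1, 0],
              vector [0, 1, 0, 1],
              vector [0, 1, 0, - 1],
              vector [1, 0, - 1, 0]] :: complex ^ 4 ^ 4) $ i $ j)"

definition \<sigma>_mat :: "complex ^ 4 ^ 4" where
  "\<sigma>_mat = vector [vector [1, 0, 0, 0],
                    vector [0, - 1, 0, 0],
                    vector [0, 0, 1, 0],
                    vector [0, 0, 0, - 1]]"

end

theory Submission
  imports Defs
begin

text \<open>The reflection \<open>(u, v) \<mapsto> (cnj v, cnj u)\<close> leaves \<open>W\<close> invariant, fixes every point of a solution with
  \<open>v\<^sub>0 = cnj u\<^sub>0\<close>, and interchanges \<open>\<partial>\<^sub>u\<close> with the derivative in \<open>cnj v\<close> and the derivative in \<open>cnj u\<close>
  with \<open>\<partial>\<^sub>v\<close>. So the Hessian along the solution commutes with the permutation \<open>(1 4)(2 3)\<close>, whose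
  eigenspaces are spanned by the first two and the last two columns of \<open>S\<close>. The only other input is
  that the two Wirtinger derivatives in \<open>u\<close> commute, which under pointwise differentiability of the first
  derivatives is Young's theorem on mixed partial derivatives.\<close>

section \<open>Symmetry of second derivatives\<close>

text \<open>Mean value theorem in direction \<open>a\<close>: the increment between the two parallel
  segments from \<open>z\<close> and from \<open>z + t *\<^sub>R b\<close> has derivative
  \<open>t *\<^sub>R A b\<close> up to \<open>o(t)\<close>, because both points are compared with
  \<open>z\<close>, the one point where \<open>f' q a\<close> is known to be differentiable.
  Integrated over length \<open>t\<close>, the error is \<open>o(t\<^sup>2)\<close>.\<close>

lemma second_difference_tendsto:
  fixes f :: "'a::real_normed_vector \<Rightarrow> 'b::real_inner"
  assumes f: "\<forall>\<^sub>F q in nhds z. (f has_derivative f' q) (at q)"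
    and A: "((\<lambda>q. f' q a) has_derivative A) (at z)"
  shows "((\<lambda>t. (f (z + t *\<^sub>R a + t *\<^sub>R b) - f (z + t *\<^sub>R a) - f (z + t *\<^sub>R b) + f z) /\<^sub>R t\<^sup>2)
           \<longlongrightarrow> A b) (at_right 0)"
proof (rule tendstoI)
  fix \<epsilon> :: real assume "\<epsilon> > 0"
  \<comment> \<open>For \<open>0 \<le> s \<le> t\<close> the two points
    \<open>z + s *\<^sub>R a + t *\<^sub>R b\<close> and \<open>z + s *\<^sub>R a\<close> have
    distances from \<open>z\<close> with sum at most \<open>t * M\<close>; the summand 1 keeps
    \<open>M\<close> positive when \<open>a = b = 0\<close>.\<close>
  define M where "M = 2 * (norm a + norm b) + 1"
  have M: "M > 0" by (simp add: M_def add_nonneg_pos)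
  \<comment> \<open>Chosen so that \<open>e * M = \<epsilon> / 2\<close>, which leaves room for the
    strict inequality at the end.\<close>
  define e where "e = \<epsilon> / (2 * M)"
  have e: "e > 0" using \<open>\<epsilon> > 0\<close> M by (simp add: e_def)
  interpret A: bounded_linear A using A by (rule has_derivative_bounded_linear)
  obtain r where r: "r > 0" "\<And>q. dist q z < r \<Longrightarrow> (f has_derivative f' q) (at q)"
    using f unfolding eventually_nhds_metric by blast
  obtain d where d: "d > 0"
    "\<And>y. norm (y - z) < d \<Longrightarrow> norm (f' y a - f' z a - A (y - z)) \<le> e * norm (y - z)"
    using A e unfolding has_derivative_at_alt by blast
  have "0 < min r d / M" using r d M by simp
  from eventually_at_right_real[OF this]
  show "\<forall>\<^sub>F t in at_right 0. dist ((f (z + t *\<^sub>R a + t *\<^sub>R b) - f (z + t *\<^sub>R a) -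
      f (z + t *\<^sub>R b) + f z) /\<^sub>R t\<^sup>2) (A b) < \<epsilon>"
  proof eventually_elim
    case (elim t)
    then have t: "t > 0" and tM: "t * M < r" "t * M < d"
      using M by (auto simp: field_simps)
    \<comment> \<open>\<open>h t - h 0\<close> is the second difference minus
      \<open>t\<^sup>2 *\<^sub>R A b\<close>, so it remains to bound \<open>h' s\<close> by
      \<open>t * (\<epsilon> / 2)\<close>.\<close>
    define h where "h = (\<lambda>s. f (z + s *\<^sub>R a + t *\<^sub>R b) - f (z + s *\<^sub>R a) - (s * t) *\<^sub>R A b)"
    define h' where "h' = (\<lambda>s. f' (z + s *\<^sub>R a + t *\<^sub>R b) a - f' (z + s *\<^sub>R a) a - t *\<^sub>R A b)"
    have small: "norm (s *\<^sub>R a + t *\<^sub>R b) + norm (s *\<^sub>R a) \<le> t * M" if "0 \<le> s" "s \<le> t" for s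
    proof -
      have "norm (s *\<^sub>R a + t *\<^sub>R b) \<le> s * norm a + t * norm b"
        using norm_triangle_ineq[of "s *\<^sub>R a" "t *\<^sub>R b"] that t by simp
      moreover have "s * norm a \<le> t * norm a" using that by (intro mult_right_mono) auto
      moreover have "t * norm b \<ge> 0" using t by simp
      moreover have "t * M = 2 * (t * norm a) + 2 * (t * norm b) + t"
        by (simp add: M_def algebra_simps)
      moreover have "norm (s *\<^sub>R a) = s * norm a" using that by simp
      ultimately show ?thesis using t by linarith
    qed
    have deriv: "(h has_derivative (\<lambda>k. k *\<^sub>R h' s)) (at s)" if "0 \<le> s" "s \<le> t" for s
    proof -
      have near: "norm (s *\<^sub>R a + t *\<^sub>R b) < r" "norm (s *\<^sub>R a) < r"
        using small[OF that] tM norm_ge_zero[of "s *\<^sub>R a + t *\<^sub>R b"] norm_ge_zero[of "s *\<^sub>R a"]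
        by linarith+
      have 1: "(f has_derivative f' (z + s *\<^sub>R a + t *\<^sub>R b)) (at (z + s *\<^sub>R a + t *\<^sub>R b))"
        using near by (intro r) (simp add: dist_norm add.assoc)
      have 2: "(f has_derivative f' (z + s *\<^sub>R a)) (at (z + s *\<^sub>R a))"
        using near by (intro r) (simp add: dist_norm)
      have "((\<lambda>s. f (z + s *\<^sub>R a + t *\<^sub>R b)) has_derivative
          (\<lambda>k. f' (z + s *\<^sub>R a + t *\<^sub>R b) (k *\<^sub>R a))) (at s)"
        by (rule has_derivative_compose[where f = "\<lambda>s. z + s *\<^sub>R a + t *\<^sub>R b", OF _ 1])
          (auto intro!: derivative_eq_intros)
      moreover have "((\<lambda>s. f (z + s *\<^sub>R a)) has_derivative (\<lambda>k. f' (z + s *\<^sub>R a) (k *\<^sub>R a))) (at s)"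
        by (rule has_derivative_compose[where f = "\<lambda>s. z + s *\<^sub>R a", OF _ 2])
          (auto intro!: derivative_eq_intros)
      ultimately show ?thesis unfolding h_def h'_def
        using linear_cmul[OF has_derivative_linear[OF 1]] linear_cmul[OF has_derivative_linear[OF 2]]
        by (auto intro!: derivative_eq_intros simp: algebra_simps)
    qed
    have "continuous_on {0..t} h"
      using deriv by (intro continuous_at_imp_continuous_on ballI has_derivative_continuous) auto
    then obtain s where s: "0 < s" "s < t" "norm (h t - h 0) \<le> norm ((t - 0) *\<^sub>R h' s)"
      using mvt_general[of 0 t h "\<lambda>s k. k *\<^sub>R h' s"] t deriv by auto
    let ?x = "s *\<^sub>R a + t *\<^sub>R b" and ?y = "s *\<^sub>R a"
    have sm: "norm ?x + norm ?y \<le> t * M" using s by (intro small) auto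
    then have "norm ?x < d" "norm ?y < d"
      using tM norm_ge_zero[of ?x] norm_ge_zero[of ?y] by linarith+
    then have b: "norm (f' (z + ?x) a - f' z a - A ?x) \<le> e * norm ?x"
      "norm (f' (z + ?y) a - f' z a - A ?y) \<le> e * norm ?y"
      using d(2)[of "z + ?x"] d(2)[of "z + ?y"] by auto
    \<comment> \<open>Since \<open>?x - ?y = t *\<^sub>R b\<close>, subtracting the two linear
      expansions at \<open>z\<close> cancels \<open>f' z a\<close> and leaves exactly the term
      \<open>t *\<^sub>R A b\<close>.\<close>
    have "h' s = (f' (z + ?x) a - f' z a - A ?x) - (f' (z + ?y) a - f' z a - A ?y)"
      by (simp add: h'_def A.add A.scaleR add.assoc)
    then have "norm (h' s) \<le> e * norm ?x + e * norm ?y"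
      using norm_triangle_ineq4 b by (smt (verit))
    also have "\<dots> \<le> e * (t * M)" using sm e by (simp flip: distrib_left)
    finally have "t * norm (h' s) \<le> t * (t * (\<epsilon> / 2))"
      using M t by (intro mult_left_mono) (simp_all add: e_def field_simps)
    moreover have "norm (h t - h 0) \<le> t * norm (h' s)" using s t by simp
    ultimately have "norm (h t - h 0) \<le> t\<^sup>2 * (\<epsilon> / 2)"
      unfolding power2_eq_square mult.assoc by (rule order_trans[rotated])
    moreover have "h t - h 0 = t\<^sup>2 *\<^sub>R ((f (z + t *\<^sub>R a + t *\<^sub>R b) - f (z + t *\<^sub>R a) -
      f (z + t *\<^sub>R b) + f z) /\<^sub>R t\<^sup>2 - A b)"
      using t by (simp add: h_def algebra_simps power2_eq_square)
    ultimately have "norm ((f (z + t *\<^sub>R a + t *\<^sub>R b) - f (z + t *\<^sub>R a) -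
      f (z + t *\<^sub>R b) + f z) /\<^sub>R t\<^sup>2 - A b) \<le> \<epsilon> / 2"
      using t by simp
    then show ?case using \<open>\<epsilon> > 0\<close> by (simp add: dist_norm)
  qed
qed

text \<open>The second difference is symmetric in \<open>a\<close> and \<open>b\<close>, so its
  limits \<open>A b\<close> and \<open>B a\<close> agree.\<close>

lemma second_derivative_symmetric:
  fixes f :: "'a::real_normed_vector \<Rightarrow> 'b::real_inner"
  assumes f: "\<forall>\<^sub>F q in nhds z. (f has_derivative f' q) (at q)"
    and A: "((\<lambda>q. f' q a) has_derivative A) (at z)"
    and B: "((\<lambda>q. f' q b) has_derivative B) (at z)"
  shows "A b = B a"
  using second_difference_tendsto[OF f A, of b] second_difference_tendsto[OF f B, of a]
  by (intro tendsto_unique[OF trivial_limit_at_right_real]) (simp_all add: algebra_simps)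

section \<open>Wirtinger derivatives\<close>

text \<open>The derivatives of \<open>g\<close> in the directions 1 and \<open>\<i>\<close> are
  linear combinations of the two Wirtinger derivatives, hence differentiable at \<open>z\<close>,
  and the symmetry of mixed derivatives applies to these directions.\<close>

lemma wirtinger_bar_wirtinger_commute:
  assumes g: "\<forall>\<^sub>F w in nhds z. g differentiable (at w)"
    and d: "wirtinger g differentiable (at z)" "wirtinger_bar g differentiable (at z)"
  shows "wirtinger_bar (wirtinger g) z = wirtinger (wirtinger_bar g) z"
proof -
  obtain A B where A: "(wirtinger g has_derivative A) (at z)"
    and B: "(wirtinger_bar g has_derivative B) (at z)"
    using d unfolding differentiable_def by blast
  have *: "\<forall>\<^sub>F w in nhds z. (g has_derivative frechet_derivative g (at w)) (at w)"
    using g by eventually_elim (simp add: frechet_derivative_works)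
  have eq: "frechet_derivative g (at w) 1 = wirtinger g w + wirtinger_bar g w"
    "frechet_derivative g (at w) \<i> = \<i> * (wirtinger g w - wirtinger_bar g w)" for w
    by (simp_all add: wirtinger_def wirtinger_bar_def field_simps)
  have "((\<lambda>w. frechet_derivative g (at w) 1) has_derivative (\<lambda>h. A h + B h)) (at z)"
    "((\<lambda>w. frechet_derivative g (at w) \<i>) has_derivative (\<lambda>h. \<i> * (A h - B h))) (at z)"
    unfolding eq using A B by (auto intro!: derivative_eq_intros)
  from second_derivative_symmetric[OF * this] have "A \<i> + B \<i> = \<i> * (A 1 - B 1)" .
  then have "\<i> * (A \<i> + B \<i>) = \<i> * (\<i> * (A 1 - B 1))" by simp
  then have "A 1 + \<i> * A \<i> = B 1 - \<i> * B \<i>" by (simp add: algebra_simps)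
  then show ?thesis
    using frechet_derivative_at[OF A] frechet_derivative_at[OF B]
    by (simp add: wirtinger_def[of "wirtinger_bar g"] wirtinger_bar_def[of "wirtinger g"])
qed

text \<open>By the chain rule, conjugation keeps the derivative in direction 1 and negates that in
  direction \<open>\<i>\<close>, which exchanges the two Wirtinger derivatives. Equality near
  \<open>z\<close> suffices, so the lemma also applies to first derivatives, which are related only
  locally.\<close>

lemma wirtinger_reflect:
  assumes eq: "\<forall>\<^sub>F w in nhds z. f w = g (cnj w)" and g: "g differentiable (at (cnj z))"
  shows "wirtinger f z = wirtinger_bar g (cnj z)" "wirtinger_bar f z = wirtinger g (cnj z)"
proof -
  obtain G where G: "(g has_derivative G) (at (cnj z))"
    using g unfolding differentiable_def by blast
  have "((\<lambda>w. g (cnj w)) has_derivative (\<lambda>h. G (cnj h))) (at z)"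
    by (rule has_derivative_compose[where f = cnj, OF _ G]) (auto intro!: derivative_eq_intros)
  then have F: "(f has_derivative (\<lambda>h. G (cnj h))) (at z)"
    by (rule has_derivative_transform_eventually)
      (use eq eventually_nhds_x_imp_x[OF eq] in \<open>auto simp: eventually_at_filter elim!: eventually_mono\<close>)
  have "G (- \<i>) = - G \<i>" using linear_neg[OF has_derivative_linear[OF G]] by simp
  then show "wirtinger f z = wirtinger_bar g (cnj z)" "wirtinger_bar f z = wirtinger g (cnj z)"
    using frechet_derivative_at[OF F, symmetric] frechet_derivative_at[OF G, symmetric]
    by (simp_all add: wirtinger_def wirtinger_bar_def)
qed

section \<open>Derivatives under the reflection\<close>

definition reflect :: "complex \<times> complex \<Rightarrow> complex \<times> complex" where
  "reflect p = (cnj (snd p), cnj (fst p))"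

lemma eventually_nhds_reflect:
  assumes "\<forall>\<^sub>F q in nhds (reflect p). P q"
  shows "\<forall>\<^sub>F q in nhds p. P (reflect q)"
proof -
  have "isCont reflect p" unfolding reflect_def by (intro continuous_intros)
  then have "filterlim reflect (nhds (reflect p)) (nhds p)"
    by (simp add: isCont_def tendsto_at_iff_tendsto_nhds)
  then show ?thesis using assms by (simp add: filterlim_iff)
qed

lemma eventually_nhds_slice:
  assumes "\<forall>\<^sub>F q in nhds p. P q"
  shows "\<forall>\<^sub>F z in nhds (fst p). P (z, snd p)" "\<forall>\<^sub>F z in nhds (snd p). P (fst p, z)"
proof -
  have "filterlim (\<lambda>z. (z, snd p)) (nhds (fst p, snd p)) (nhds (fst p))"
    "filterlim (\<lambda>z. (fst p, z)) (nhds (fst p, snd p)) (nhds (snd p))"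
    by (intro tendsto_intros filterlim_ident)+
  then show "\<forall>\<^sub>F z in nhds (fst p). P (z, snd p)" "\<forall>\<^sub>F z in nhds (snd p). P (fst p, z)"
    using assms by (simp_all add: filterlim_iff)
qed

text \<open>Freezing one variable of \<open>F\<close> freezes the other variable of \<open>G\<close>
  at the conjugate value, so each slice is a case of \<open>wirtinger_reflect\<close>.\<close>

lemma wirtinger_derivs_reflect:
  assumes eq: "\<forall>\<^sub>F q in nhds p. F q = G (reflect q)" and G: "wirtinger_derivs_exist G (reflect p)"
  shows "d_u F p = d_vb G (reflect p)" "d_ub F p = d_v G (reflect p)"
    "d_v F p = d_ub G (reflect p)" "d_vb F p = d_u G (reflect p)"
  unfolding d_u_def d_ub_def d_v_def d_vb_def
  using wirtinger_reflect[of "\<lambda>z. F (z, snd p)" "\<lambda>z. G (fst (reflect p), z)" "fst p"]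
    wirtinger_reflect[of "\<lambda>z. F (fst p, z)" "\<lambda>z. G (z, snd (reflect p))" "snd p"]
    eventually_nhds_slice[OF eq] G
  by (simp_all add: reflect_def wirtinger_derivs_exist_def)

text \<open>\<open>wirtinger_derivs_reflect\<close> is applied to \<open>W\<close> near
  \<open>p\<close>, then to each first derivative at \<open>p\<close>. The eight equations pair the
  sixteen entries of \<open>V_mat\<close> under the permutation (1 4)(2 3), oriented so that
  rewriting turns rows 3 and 4 into entries of rows 1 and 2.\<close>

lemma second_derivs_reflect:
  assumes W: "\<And>q. W q = W (reflect q)" and p: "reflect p = p"
    and ex: "second_wirtinger_derivs_exist W p"
  shows "d_v (d_vb W) p = d_ub (d_u W) p" "d_vb (d_v W) p = d_u (d_ub W) p"
    "d_v (d_u W) p = d_ub (d_vb W) p" "d_vb (d_ub W) p = d_u (d_v W) p"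
    "d_v (d_v W) p = d_ub (d_ub W) p" "d_v (d_ub W) p = d_ub (d_v W) p"
    "d_vb (d_vb W) p = d_u (d_u W) p" "d_vb (d_u W) p = d_u (d_vb W) p"
proof -
  have ev: "\<forall>\<^sub>F q in nhds p. wirtinger_derivs_exist W (reflect q)"
    using ex p by (intro eventually_nhds_reflect) (simp add: second_wirtinger_derivs_exist_def)
  have first: "\<forall>\<^sub>F q in nhds p. d_u W q = d_vb W (reflect q)"
    "\<forall>\<^sub>F q in nhds p. d_ub W q = d_v W (reflect q)"
    "\<forall>\<^sub>F q in nhds p. d_v W q = d_ub W (reflect q)"
    "\<forall>\<^sub>F q in nhds p. d_vb W q = d_u W (reflect q)"
    by (use ev in eventually_elim, intro wirtinger_derivs_reflect always_eventually allI W, assumption)+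
  have "wirtinger_derivs_exist (d_u W) (reflect p)" "wirtinger_derivs_exist (d_ub W) (reflect p)"
    "wirtinger_derivs_exist (d_v W) (reflect p)" "wirtinger_derivs_exist (d_vb W) (reflect p)"
    using ex p by (simp_all add: second_wirtinger_derivs_exist_def)
  note second = wirtinger_derivs_reflect[OF first(1) this(4)] wirtinger_derivs_reflect[OF first(2) this(3)]
    wirtinger_derivs_reflect[OF first(3) this(2)] wirtinger_derivs_reflect[OF first(4) this(1)]
  show "d_v (d_vb W) p = d_ub (d_u W) p" "d_vb (d_v W) p = d_u (d_ub W) p"
    "d_v (d_u W) p = d_ub (d_vb W) p" "d_vb (d_ub W) p = d_u (d_v W) p"
    "d_v (d_v W) p = d_ub (d_ub W) p" "d_v (d_ub W) p = d_ub (d_v W) p"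
    "d_vb (d_vb W) p = d_u (d_u W) p" "d_vb (d_u W) p = d_u (d_vb W) p"
    using second p by simp_all
qed

text \<open>Needed for the lower right entry: \<open>V_sign\<close> has \<open>d_ub (d_u W)\<close>
  there, while the Hessian yields \<open>d_u (d_ub W)\<close>.\<close>

lemma d_ub_d_u_commute:
  assumes "second_wirtinger_derivs_exist W p"
  shows "d_u (d_ub W) p = d_ub (d_u W) p"
proof -
  let ?g = "\<lambda>z. W (z, snd p)"
  have "\<forall>\<^sub>F z in nhds (fst p). ?g differentiable (at z)"
    using assms eventually_nhds_slice(1)[of "wirtinger_derivs_exist W" p]
    by (auto simp: second_wirtinger_derivs_exist_def wirtinger_derivs_exist_def elim: eventually_mono)
  moreover have "wirtinger ?g differentiable (at (fst p))" "wirtinger_bar ?g differentiable (at (fst p))"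
    using assms
    by (auto simp: second_wirtinger_derivs_exist_def wirtinger_derivs_exist_def d_u_def d_ub_def)
  ultimately show ?thesis
    using wirtinger_bar_wirtinger_commute[of ?g "fst p"] by (simp add: d_u_def d_ub_def)
qed

section \<open>Block diagonalization\<close>

lemma vector_4 [simp]:
  "(vector [a, b, c, d] :: 'a::zero ^ 4) $ 1 = a" "(vector [a, b, c, d] :: 'a ^ 4) $ 2 = b"
  "(vector [a, b, c, d] :: 'a ^ 4) $ 3 = c" "(vector [a, b, c, d] :: 'a ^ 4) $ 4 = d"
  unfolding vector_def by simp_all

lemma matrix_vector_mult_nth: "(M *v a) $ i = (\<Sum>j\<in>UNIV. M $ i $ j * a $ j)"
  by (simp add: matrix_vector_mult_def)

text \<open>A separate constant hides the square root, so that products reduce by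
  \<open>inv_sqrt2_square\<close> alone.\<close>

definition inv_sqrt2 :: complex where
  "inv_sqrt2 = complex_of_real (1 / sqrt 2)"

lemma inv_sqrt2_square: "inv_sqrt2 * (inv_sqrt2 * z) = z / 2"
proof -
  have "inv_sqrt2 * inv_sqrt2 = 1 / 2"
    unfolding inv_sqrt2_def of_real_mult[symmetric] by simp
  then show ?thesis by (simp flip: mult.assoc)
qed

lemma S_mat_mult:
  "S_mat *v a = vector [inv_sqrt2 * (a $ 1 + a $ 3), inv_sqrt2 * (a $ 2 + a $ 4),
     inv_sqrt2 * (a $ 2 - a $ 4), inv_sqrt2 * (a $ 1 - a $ 3)]"
  by (simp add: vec_eq_iff forall_4 matrix_vector_mult_def sum_4 S_mat_def inv_sqrt2_def
      add_divide_distrib diff_divide_distrib)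

lemma transpose_S_mat_mult:
  "transpose S_mat *v a = vector [inv_sqrt2 * (a $ 1 + a $ 4), inv_sqrt2 * (a $ 2 + a $ 3),
     inv_sqrt2 * (a $ 1 - a $ 4), inv_sqrt2 * (a $ 2 - a $ 3)]"
  by (simp add: vec_eq_iff forall_4 matrix_vector_mult_def sum_4 transpose_def S_mat_def
      inv_sqrt2_def add_divide_distrib diff_divide_distrib del: transpose_matrix_vector)

lemma \<sigma>_mat_mult: "\<sigma>_mat *v a = vector [a $ 1, - a $ 2, a $ 3, - a $ 4]"
  by (simp add: vec_eq_iff forall_4 matrix_vector_mult_def sum_4 \<sigma>_mat_def)

lemma orthogonal_S_mat: "transpose S_mat ** S_mat = mat 1" "S_mat ** transpose S_mat = mat 1"
  unfolding matrix_eq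
  by (simp_all add: vec_eq_iff forall_4 S_mat_mult transpose_S_mat_mult algebra_simps
      inv_sqrt2_square flip: matrix_vector_mul_assoc del: transpose_matrix_vector)

lemma matrix_inv_S_mat: "matrix_inv S_mat = transpose S_mat"
proof -
  \<comment> \<open>\<open>matrix_inv\<close> is a chosen inverse; the transpose shows that one
    exists, and multiplying by it on the left then identifies the choice.\<close>
  have "S_mat ** matrix_inv S_mat = mat 1"
    unfolding matrix_inv_def by (rule someI2[of _ "transpose S_mat"]) (simp_all add: orthogonal_S_mat)
  then show ?thesis
    by (metis orthogonal_S_mat(1) matrix_mul_assoc matrix_mul_lid matrix_mul_rid)
qed

section \<open>Conjugation of the operators\<close>

text \<open>A constant matrix commutes with the derivative. Differentiability is what makes
  \<open>vector_derivative\<close> linear here.\<close>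

lemma D_x_mat_op:
  fixes M :: "complex ^ 'n ^ 'm"
  assumes "\<Phi> differentiable (at x)"
  shows "D_x (mat_op M \<Phi>) k x = (M *v (\<chi> j. D_x \<Phi> j x)) $ k"
proof -
  obtain F where F: "(\<Phi> has_derivative F) (at x)"
    using assms unfolding differentiable_def by blast
  have "((\<lambda>y. \<Phi> y $ j) has_vector_derivative D_x \<Phi> j x) (at x)" for j
    using bounded_linear.has_derivative[OF bounded_linear_vec_nth F, of j]
    by (auto simp: vector_derivative_works[symmetric] differentiable_def)
  then have "((\<lambda>y. \<Sum>j\<in>UNIV. M $ k $ j * \<Phi> y $ j) has_vector_derivative
      (\<Sum>j\<in>UNIV. M $ k $ j * D_x \<Phi> j x)) (at x)"
    by (intro has_vector_derivative_sum has_vector_derivative_mult_right)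
  then show ?thesis
    by (simp add: mat_op_def matrix_vector_mult_def vector_derivative_at)
qed

text \<open>Conjugation by \<open>\<sigma>_mat\<close> negates the permutation (1 4)(2 3), so
  \<open>\<sigma>_mat\<close> exchanges its eigenspaces:
  \<open>S\<^sup>T \<sigma> S = \<sigma> J\<close> with \<open>J\<close> the exchange of the two
  blocks. This makes the second operator block off-diagonal.\<close>

lemma block_diagonalization:
  assumes \<Phi>: "\<Phi> differentiable (at x)"
    and p: "p = (u0 x, v0 x)" "reflect p = p"
    and W: "\<And>q. W q = W (reflect q)" and ex: "second_wirtinger_derivs_exist W p"
  shows "mat_op (transpose S_mat) (H_energy \<omega> W u0 v0 (mat_op S_mat \<Phi>)) x =
      block_op (H_plus \<omega> W u0 v0) zero_op zero_op (H_minus \<omega> W u0 v0) \<Phi> x"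
    and "mat_op (transpose S_mat) (mat_op \<sigma>_mat (H_energy \<omega> W u0 v0 (mat_op S_mat \<Phi>))) x =
      mat_op \<sigma>_mat (block_op zero_op (H_minus \<omega> W u0 v0) (H_plus \<omega> W u0 v0) zero_op \<Phi>) x"
proof -
  note V = second_derivs_reflect[OF W p(2) ex] d_ub_d_u_commute[OF ex]
  note D = D_x_mat_op[OF \<Phi>, of S_mat]
  note ops = vec_eq_iff forall_4 sum_4 sum_2 mat_op_def S_mat_mult transpose_S_mat_mult \<sigma>_mat_mult
    block_op_def H_sign_def zero_op_def Let_def matrix_vector_mult_nth
    V_mat_def V_sign_def V
  show "mat_op (transpose S_mat) (H_energy \<omega> W u0 v0 (mat_op S_mat \<Phi>)) x =
      block_op (H_plus \<omega> W u0 v0) zero_op zero_op (H_minus \<omega> W u0 v0) \<Phi> x"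
    \<comment> \<open>Only the outer \<open>mat_op\<close> is unfolded, so that \<open>D\<close>
      still matches the inner one; folding \<open>(u0 x, v0 x)\<close> back to \<open>p\<close> lets
      the Hessian symmetries \<open>V\<close> apply.\<close>
    unfolding mat_op_def[of "transpose S_mat"] H_energy_def D_op_def D
    by (simp add: ops flip: p(1) del: transpose_matrix_vector) (simp add: algebra_simps inv_sqrt2_square)
  show "mat_op (transpose S_mat) (mat_op \<sigma>_mat (H_energy \<omega> W u0 v0 (mat_op S_mat \<Phi>))) x =
      mat_op \<sigma>_mat (block_op zero_op (H_minus \<omega> W u0 v0) (H_plus \<omega> W u0 v0) zero_op \<Phi>) x"
    unfolding mat_op_def[of "transpose S_mat"] mat_op_def[of \<sigma>_mat] H_energy_def D_op_def D
    by (simp add: ops flip: p(1) del: transpose_matrix_vector) (simp add: algebra_simps inv_sqrt2_square)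
qed

theorem theorem4p2:
  fixes W :: "complex \<times> complex \<Rightarrow> complex"
    and \<omega> :: real
    and u0 v0 :: "real \<Rightarrow> complex"
  assumes real_valued: "\<forall>p. W p \<in> \<real>"
    and conj: "conj_symmetric W"
    and gauge: "gauge_invariant W"
    and swap: "swap_symmetric W"
    and analytic: "analytic_O4_at_0 W"
    and derivs: "\<forall>x. second_wirtinger_derivs_exist W (u0 x, v0 x)"
    and solution: "stationary_solution \<omega> W u0 v0"
    and decay: "decaying u0" "decaying v0"
    and reduction: "\<forall>x. v0 x = cnj (u0 x)"
  shows "\<exists>S. S = S_mat \<and> orthogonal_matrix S \<and> matrix_inv S = transpose S \<and>
    (\<forall>\<Phi>. (\<forall>x. \<Phi> differentiable (at x)) \<longrightarrow>
       mat_op (matrix_inv S) (H_energy \<omega> W u0 v0 (mat_op S \<Phi>)) =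
         block_op (H_plus \<omega> W u0 v0) zero_op zero_op (H_minus \<omega> W u0 v0) \<Phi> \<and>
       mat_op (matrix_inv S) (mat_op \<sigma>_mat (H_energy \<omega> W u0 v0 (mat_op S \<Phi>))) =
         mat_op \<sigma>_mat
           (block_op zero_op (H_minus \<omega> W u0 v0) (H_plus \<omega> W u0 v0) zero_op \<Phi>))"
proof -
  \<comment> \<open>The reflection is conjugation of both variables followed by the interchange, and
    each of them preserves \<open>W\<close>.\<close>
  have W: "W q = W (reflect q)" for q
    using conj swap by (cases q) (simp add: conj_symmetric_def swap_symmetric_def reflect_def)
  have p: "reflect (u0 x, v0 x) = (u0 x, v0 x)" for x
    using reduction by (simp add: reflect_def)
  note block = block_diagonalization[OF _ refl p W derivs[rule_format]]
  show ?thesis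
    by (intro exI[of _ S_mat] conjI refl allI impI ext)
      (simp_all add: orthogonal_matrix_def orthogonal_S_mat matrix_inv_S_mat block)
qed

end
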